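(* Let $k\ge 3$, $g\ge 1$ and $c\ge 2$ be integers such that a transversal design {\rm TD}$(k,g)$ exists, let $v=kg$, and suppose $c$ divides $k$. Write $k=qc+b$ and $v=\rho c+\beta$ with integers $q,\rho$ and $0\le b<c$, $0\le \beta<c$. Then there exists a block-equitably $c$-coloured packing {\rm PD}$(v,k,1)$ whose number of blocks equals \[ \frac{\rho\left(\frac{\rho c}{2}+\beta\right)(c-1)+\frac{\beta}{2}(\beta-1)}{q\left(\frac{qc}{2}+b\right)(c-1)+\frac{b}{2}(b-1)}. \]
   Context: A transversal design {\rm TD}$(k,g)$ is a set of $kg$ points partitioned into $k$ groups of size $g$, together with a collection of $k$-subsets (blocks) such that every pair of points from distinct groups lies in exactly one block and no pair from the same group lies in a block. A packing design {\rm PD}$(v,k,1)$ is a pair $(V,{\cal B})$ with $|V|=v$ and ${\cal B}$ a collection of $k$-subsets of $V$ such that every pair of points lies in at most one block; its size is $|{\cal B}|$. A $c$-colouring is a function $f:V\to{\cal C}$ with $|{\cal C}|=c$, colour classes $F(\gamma)=f^{-1}(\gamma)$; it is block-equitable if $\lfloor k/c\rfloor\le |B\cap F(\gamma)|\le\lceil k/c\rceil$ for every colour $\gamma$ and block $B$. *)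

theory Defs
  imports Complex_Main "HOL-Library.Disjoint_Sets" "HOL-Library.FuncSet"
begin

text \<open>
  Block collections are plain sets. For block size at least 2 this loses nothing, since two
  equal copies of a block would violate the condition on pairs.
\<close>

definition transversal_design ::
  "nat \<Rightarrow> nat \<Rightarrow> 'a set \<Rightarrow> 'a set set \<Rightarrow> 'a set set \<Rightarrow> bool" where
  "transversal_design k g V \<G> \<B> \<longleftrightarrow>
     finite V \<and> card V = k * g \<and>
     partition_on V \<G> \<and> card \<G> = k \<and> (\<forall>G\<in>\<G>. card G = g) \<and>
     (\<forall>B\<in>\<B>. B \<subseteq> V \<and> card B = k) \<and>
     (\<forall>G\<in>\<G>. \<forall>H\<in>\<G>. G \<noteq> H \<longrightarrow>
        (\<forall>x\<in>G. \<forall>y\<in>H. \<exists>!B. B \<in> \<B> \<and> {x, y} \<subseteq> B)) \<and>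
     (\<forall>G\<in>\<G>. \<forall>x\<in>G. \<forall>y\<in>G. x \<noteq> y \<longrightarrow> \<not> (\<exists>B\<in>\<B>. {x, y} \<subseteq> B))"

definition packing_design :: "nat \<Rightarrow> nat \<Rightarrow> 'a set \<Rightarrow> 'a set set \<Rightarrow> bool" where
  "packing_design v k V \<B> \<longleftrightarrow>
     finite V \<and> card V = v \<and>
     (\<forall>B\<in>\<B>. B \<subseteq> V \<and> card B = k) \<and>
     (\<forall>x\<in>V. \<forall>y\<in>V. x \<noteq> y \<longrightarrow> (\<exists>\<^sub>\<le>\<^sub>1 B. B \<in> \<B> \<and> {x, y} \<subseteq> B))"

definition colouring :: "nat \<Rightarrow> 'a set \<Rightarrow> 'c set \<Rightarrow> ('a \<Rightarrow> 'c) \<Rightarrow> bool" where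
  "colouring c V C f \<longleftrightarrow> finite C \<and> card C = c \<and> f \<in> V \<rightarrow> C"

definition colour_class :: "'a set \<Rightarrow> ('a \<Rightarrow> 'c) \<Rightarrow> 'c \<Rightarrow> 'a set" where
  "colour_class V f \<gamma> = {x \<in> V. f x = \<gamma>}"

definition block_equitable ::
  "nat \<Rightarrow> nat \<Rightarrow> 'a set \<Rightarrow> 'a set set \<Rightarrow> 'c set \<Rightarrow> ('a \<Rightarrow> 'c) \<Rightarrow> bool" where
  "block_equitable k c V \<B> C f \<longleftrightarrow>
     (\<forall>\<gamma>\<in>C. \<forall>B\<in>\<B>.
        \<lfloor>real k / real c\<rfloor> \<le> int (card (B \<inter> colour_class V f \<gamma>)) \<and>
        int (card (B \<inter> colour_class V f \<gamma>)) \<le> \<lceil>real k / real c\<rceil>)"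

end

theory Submission
  imports Defs
begin

text \<open>
  A block of a transversal design has as many points as there are groups and at most one point in
  each of them, so it meets every group exactly once. Hence assigning each colour to exactly
  \<open>k / c\<close> whole groups makes every block contain exactly \<open>k / c\<close> points of each colour.
  Since the points of a block in two fixed groups determine the block, there are \<open>g\<^sup>2\<close> blocks, and
  this is the value of the stated quotient because \<open>c\<close> divides \<open>k\<close> and \<open>v\<close>.
\<close>

text \<open>Parts of a partition are disjoint, so intersections with \<open>B\<close> add up. The
  subfamily \<open>\<H>\<close> is kept general for two uses: all groups, to count a whole block,
  and the groups of one colour.\<close>

lemma card_Int_Union_partition_on:
  assumes "partition_on V \<G>" "finite V" "\<H> \<subseteq> \<G>"
  shows "card (B \<inter> \<Union>\<H>) = (\<Sum>G\<in>\<H>. card (B \<inter> G))"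
proof -
  have "finite \<H>"
    using assms finite_elements finite_subset by blast
  moreover have "finite (B \<inter> G)" if "G \<in> \<H>" for G
    using that assms partition_onD1 by (metis Sup_upper finite_Int finite_subset subsetD)
  moreover have "(B \<inter> G) \<inter> (B \<inter> H) = {}" if "G \<in> \<H>" "H \<in> \<H>" "G \<noteq> H" for G H
    using that assms partition_onD2[OF assms(1)] by (auto simp: disjoint_def)
  ultimately have "card (\<Union>G\<in>\<H>. B \<inter> G) = (\<Sum>G\<in>\<H>. card (B \<inter> G))"
    by (intro card_UN_disjoint) auto
  then show ?thesis
    by (simp only: Int_Union)
qed

lemma transversal_design_ex1_block:
  assumes td: "transversal_design k g V \<G> \<B>"
    and "G \<in> \<G>" "H \<in> \<G>" "G \<noteq> H" "x \<in> G" "y \<in> H"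
  shows "\<exists>!B. B \<in> \<B> \<and> {x, y} \<subseteq> B"
proof -
  have "\<forall>G\<in>\<G>. \<forall>H\<in>\<G>. G \<noteq> H \<longrightarrow>
      (\<forall>x\<in>G. \<forall>y\<in>H. \<exists>!B. B \<in> \<B> \<and> {x, y} \<subseteq> B)"
    using td unfolding transversal_design_def by (elim conjE)
  from this[rule_format, OF assms(2-6)] show ?thesis .
qed

lemma transversal_design_same_group:
  assumes td: "transversal_design k g V \<G> \<B>"
    and "G \<in> \<G>" "x \<in> G" "y \<in> G" "B \<in> \<B>" "x \<in> B" "y \<in> B"
  shows "x = y"
proof -
  have "\<forall>G\<in>\<G>. \<forall>x\<in>G. \<forall>y\<in>G. x \<noteq> y \<longrightarrow> \<not> (\<exists>B\<in>\<B>. {x, y} \<subseteq> B)"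
    using td unfolding transversal_design_def by (elim conjE)
  then have "x \<noteq> y \<longrightarrow> \<not> (\<exists>B\<in>\<B>. {x, y} \<subseteq> B)"
    using assms(2-4) by blast
  then show ?thesis
    using assms(5-7) by blast
qed

text \<open>The \<open>k\<close> groups cut the \<open>k\<close> points of \<open>B\<close> into
  \<open>k\<close> pieces of size at most 1. These sizes add up to \<open>k\<close>, so none of them
  can be 0.\<close>

lemma transversal_design_card_block_Int_group:
  assumes td: "transversal_design k g V \<G> \<B>" and B: "B \<in> \<B>" and G: "G \<in> \<G>"
  shows "card (B \<inter> G) = 1"
proof -
  have part: "partition_on V \<G>" and fin: "finite V" and k: "card \<G> = k" "card B = k" "B \<subseteq> V"
    using td B by (simp_all add: transversal_design_def)
  have finG: "finite \<G>"
    using fin part finite_elements by blast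
  have le: "card (B \<inter> H) \<le> 1" if "H \<in> \<G>" for H
  proof -
    have "x = y" if "x \<in> B \<inter> H" "y \<in> B \<inter> H" for x y
      using transversal_design_same_group[OF td \<open>H \<in> \<G>\<close> _ _ B] that by blast
    \<comment> \<open>\<open>card_le_Suc0_iff_eq\<close> asks for finiteness; an infinite set has
      \<open>card\<close> 0 by convention, so the bound holds there too.\<close>
    then show ?thesis
      by (metis One_nat_def card_le_Suc0_iff_eq card.infinite zero_le)
  qed
  have "(\<Sum>H\<in>\<G>. card (B \<inter> H)) = card B"
    using card_Int_Union_partition_on[OF part fin order_refl, of B] partition_onD1[OF part] k
    by (simp add: Int_absorb2)
  then have "(\<Sum>H\<in>\<G>. card (B \<inter> H)) = (\<Sum>H\<in>\<G>. 1)"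
    using k by simp
  \<comment> \<open>Termwise \<le> together with equal finite sums forces equality in every
    term.\<close>
  then show ?thesis
    using sum_mono_inv[where f = "\<lambda>H. card (B \<inter> H)" and g = "\<lambda>_. 1" and I = \<G>] le G finG
    by simp
qed

text \<open>Fix two distinct groups, which exist as \<open>k \<ge> 2\<close>, and send each block to
  its pair of points in them. Every such pair lies in exactly one block, so this is a bijection onto
  a product of two sets of size \<open>g\<close>.\<close>

lemma transversal_design_card_blocks:
  assumes td: "transversal_design k g V \<G> \<B>" and "k \<ge> 2"
  shows "card \<B> = g\<^sup>2"
proof -
  have "\<exists>G\<in>\<G>. \<exists>H\<in>\<G>. G \<noteq> H"
  proof (rule ccontr)
    assume "\<not> ?thesis"
    then have "card \<G> \<le> 1"
      by (metis One_nat_def card_le_Suc0_iff_eq card.infinite zero_le)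
    then show False
      using td \<open>k \<ge> 2\<close> by (simp add: transversal_design_def)
  qed
  then obtain G H where GH: "G \<in> \<G>" "H \<in> \<G>" "G \<noteq> H"
    by blast
  \<comment> \<open>The point where the block \<open>B\<close> meets the group \<open>K\<close>;
    \<open>the_elem\<close> is meaningful because the intersection is a singleton.\<close>
  define pt where "pt B K = the_elem (B \<inter> K)" for B K :: "'a set"
  have pt: "B \<inter> K = {pt B K}" if "B \<in> \<B>" "K \<in> \<G>" for B K
    using transversal_design_card_block_Int_group[OF td that]
    by (metis pt_def card_1_singletonE the_elem_eq)
  have uniq: "\<exists>!B. B \<in> \<B> \<and> {x, y} \<subseteq> B" if "x \<in> G" "y \<in> H" for x y
    using transversal_design_ex1_block[OF td GH that] .
  have mem: "pt B K \<in> B" "pt B K \<in> K" if "B \<in> \<B>" "K \<in> \<G>" for B K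
    using pt[OF that] by blast+
  have "bij_betw (\<lambda>B. (pt B G, pt B H)) \<B> (G \<times> H)"
  proof (rule bij_betw_imageI)
    show "inj_on (\<lambda>B. (pt B G, pt B H)) \<B>"
    proof (rule inj_onI)
      fix A B assume AB: "A \<in> \<B>" "B \<in> \<B>" and eq: "(pt A G, pt A H) = (pt B G, pt B H)"
      have "pt A G \<in> A \<inter> B" "pt A H \<in> A \<inter> B" "pt A G \<in> G" "pt A H \<in> H"
        using eq mem[OF AB(1) GH(1)] mem[OF AB(1) GH(2)] mem[OF AB(2) GH(1)] mem[OF AB(2) GH(2)]
        by simp_all
      then show "A = B"
        using uniq[of "pt A G" "pt A H"] AB by blast
    qed
    show "(\<lambda>B. (pt B G, pt B H)) ` \<B> = G \<times> H"
    proof (rule subset_antisym; rule subsetI)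
      fix p assume "p \<in> G \<times> H"
      then obtain x y where p: "p = (x, y)" "x \<in> G" "y \<in> H"
        by blast
      obtain B where B: "B \<in> \<B>" "x \<in> B" "y \<in> B"
        using ex1_implies_ex[OF uniq[OF p(2,3)]] by auto
      have "x \<in> B \<inter> G" "y \<in> B \<inter> H"
        using p B by blast+
      then have "pt B G = x" "pt B H = y"
        by (simp_all add: pt[OF B(1) GH(1)] pt[OF B(1) GH(2)])
      then show "p \<in> (\<lambda>B. (pt B G, pt B H)) ` \<B>"
        using p B by blast
    qed (use mem GH(1,2) in blast)
  qed
  then have "card \<B> = card (G \<times> H)"
    by (rule bij_betw_same_card)
  moreover have "card G = g" "card H = g"
    using td GH by (simp_all add: transversal_design_def)
  ultimately show ?thesis
    by (simp add: card_cartesian_product power2_eq_square)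
qed

text \<open>Two distinct points share no block if they are in the same group and exactly one
  otherwise, hence at most one in either case.\<close>

lemma transversal_design_imp_packing_design:
  assumes td: "transversal_design k g V \<G> \<B>"
  shows "packing_design (k * g) k V \<B>"
proof -
  have part: "partition_on V \<G>"
    using td by (simp add: transversal_design_def)
  have "\<exists>\<^sub>\<le>\<^sub>1 B. B \<in> \<B> \<and> {x, y} \<subseteq> B" if xy: "x \<in> V" "y \<in> V" "x \<noteq> y" for x y
  proof -
    obtain G H where GH: "G \<in> \<G>" "x \<in> G" "H \<in> \<G>" "y \<in> H"
      using partition_onD1[OF part] xy by blast
    show ?thesis
    proof (cases "G = H")
      case True
      then have "\<not> (\<exists>B\<in>\<B>. {x, y} \<subseteq> B)"
        using transversal_design_same_group[OF td \<open>G \<in> \<G>\<close>] GH xy by blast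
      then show ?thesis
        by (auto simp: Uniq_def)
    next
      case False
      then have "\<exists>!B. B \<in> \<B> \<and> {x, y} \<subseteq> B"
        using transversal_design_ex1_block[OF td] GH by blast
      then show ?thesis
        by (auto simp: Uniq_def)
    qed
  qed
  then show ?thesis
    using td by (simp add: transversal_design_def packing_design_def)
qed

text \<open>The class is parametrised by \<open>j * c + \<gamma>\<close> with \<open>j < m\<close>.
  It will count the groups that receive the colour \<open>\<gamma>\<close>.\<close>

lemma card_residue_class_lessThan:
  fixes c :: nat
  assumes "\<gamma> < c"
  shows "card {i \<in> {..<m * c}. i mod c = \<gamma>} = m"
proof -
  have "{i \<in> {..<m * c}. i mod c = \<gamma>} = (\<lambda>j. j * c + \<gamma>) ` {..<m}"
  proof (intro subset_antisym subsetI)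
    fix i assume i: "i \<in> {i \<in> {..<m * c}. i mod c = \<gamma>}"
    then have "i = (i div c) * c + \<gamma>" "i div c < m"
      using div_mult_mod_eq[of i c] by (auto simp: less_mult_imp_div_less)
    then show "i \<in> (\<lambda>j. j * c + \<gamma>) ` {..<m}"
      by blast
  next
    fix i assume "i \<in> (\<lambda>j. j * c + \<gamma>) ` {..<m}"
    then obtain j where j: "j < m" "i = j * c + \<gamma>"
      by blast
    have "i < Suc j * c"
      using j assms by simp
    also have "\<dots> \<le> m * c"
      using j by (intro mult_le_mono1) simp
    finally show "i \<in> {i \<in> {..<m * c}. i mod c = \<gamma>}"
      using j assms by simp
  qed
  moreover have "inj_on (\<lambda>j. j * c + \<gamma>) {..<m}"
    using assms by (auto simp: inj_on_def)
  ultimately show ?thesis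
    by (simp add: card_image)
qed

text \<open>Number the groups from 0 to \<open>m * c - 1\<close> and colour each point by the number
  of its group modulo \<open>c\<close>. Each colour then owns \<open>m\<close> groups, and a block
  has one point in each of them.\<close>

lemma transversal_design_equitable_colouring:
  assumes td: "transversal_design (m * c) g V \<G> \<B>" and "c > 0"
  obtains f where "colouring c V {..<c} f" "block_equitable (m * c) c V \<B> {..<c} f"
proof -
  have part: "partition_on V \<G>" and fin: "finite V" and k: "card \<G> = m * c"
    using td by (simp_all add: transversal_design_def)
  have "finite \<G>"
    using fin part finite_elements by blast
  then obtain h where h: "bij_betw h \<G> {..<m * c}"
    using k ex_bij_betw_finite_nat[of \<G>] by (auto simp: atLeast0LessThan)
  \<comment> \<open>For \<open>x\<close> in \<open>V\<close> the description denotes the unique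
    group containing \<open>x\<close>. Outside \<open>V\<close> its value is unspecified, but the
    result is still below \<open>c\<close>.\<close>
  define f where "f x = h (THE G. G \<in> \<G> \<and> x \<in> G) mod c" for x
  have f: "f x = h G mod c" if "G \<in> \<G>" "x \<in> G" for x G
  proof -
    have "(THE G. G \<in> \<G> \<and> x \<in> G) = G"
      using that partition_onD2[OF part] by (intro the_equality) (auto simp: disjoint_def)
    then show ?thesis
      by (simp add: f_def)
  qed
  have card_eq: "card (B \<inter> colour_class V f \<gamma>) = m" if "\<gamma> < c" "B \<in> \<B>" for B \<gamma>
  proof -
    define \<H> where "\<H> = {G \<in> \<G>. h G mod c = \<gamma>}"
    have "colour_class V f \<gamma> = \<Union>\<H>"
      using f partition_onD1[OF part] unfolding colour_class_def \<H>_def by fastforce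
    then have "card (B \<inter> colour_class V f \<gamma>) = (\<Sum>G\<in>\<H>. card (B \<inter> G))"
      using card_Int_Union_partition_on[OF part fin] by (simp add: \<H>_def)
    also have "\<dots> = card \<H>"
      using transversal_design_card_block_Int_group[OF td \<open>B \<in> \<B>\<close>] by (simp add: \<H>_def)
    \<comment> \<open>Injectivity of \<open>h\<close> turns the count of groups of colour
      \<open>\<gamma>\<close> into a count of numbers in a residue class.\<close>
    also have "\<dots> = card (h ` \<H>)"
      using h by (intro card_image[symmetric]) (auto simp: bij_betw_def \<H>_def inj_on_def)
    also have "h ` \<H> = {i \<in> {..<m * c}. i mod c = \<gamma>}"
      unfolding bij_betw_imp_surj_on[OF h, symmetric] \<H>_def by blast
    finally show ?thesis
      using card_residue_class_lessThan[OF \<open>\<gamma> < c\<close>] by simp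
  qed
  have "colouring c V {..<c} f"
    using \<open>c > 0\<close> by (auto simp: colouring_def f_def)
  \<comment> \<open>Here \<open>k / c\<close> is the integer \<open>m\<close>, so floor and ceiling
    coincide and both bounds become the equality \<open>card_eq\<close>.\<close>
  moreover have "block_equitable (m * c) c V \<B> {..<c} f"
    using \<open>c > 0\<close> card_eq by (simp add: block_equitable_def)
  ultimately show ?thesis
    using that by blast
qed

theorem theorem2p9:
  fixes k g c v :: nat and q \<rho> b \<beta> :: int
  assumes "k \<ge> 3" and "g \<ge> 1" and "c \<ge> 2"
    and "\<exists>(X :: 'a set) \<G> \<A>. transversal_design k g X \<G> \<A>"
    and "v = k * g"
    and "c dvd k"
    and "int k = q * int c + b" and "0 \<le> b" and "b < int c"
    and "int v = \<rho> * int c + \<beta>" and "0 \<le> \<beta>" and "\<beta> < int c"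
  shows "\<exists>(V :: 'a set) \<B> (C :: nat set) f.
           packing_design v k V \<B> \<and> colouring c V C f \<and> block_equitable k c V \<B> C f \<and>
           real (card \<B>) =
             (real_of_int \<rho> * (real_of_int \<rho> * real c / 2 + real_of_int \<beta>) * (real c - 1)
                + real_of_int \<beta> / 2 * (real_of_int \<beta> - 1)) /
             (real_of_int q * (real_of_int q * real c / 2 + real_of_int b) * (real c - 1)
                + real_of_int b / 2 * (real_of_int b - 1))"
proof -
  obtain V :: "'a set" and \<G> \<B> where td: "transversal_design k g V \<G> \<B>"
    using assms(4) by blast
  obtain m where m: "k = m * c"
    using \<open>c dvd k\<close> by (metis dvd_def mult.commute)
  \<comment> \<open>Uniqueness of division with remainder for a multiple of \<open>c\<close>. It
    applies to both \<open>k\<close> and \<open>v\<close>, so both remainders vanish.\<close>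
  have quotient_unique: "x = y \<and> r = 0"
    if "y * int c = x * int c + r" "0 \<le> r" "r < int c" for x y r
  proof -
    have "r = (x * int c + r) mod int c"
      using that(2,3) by simp
    also have "\<dots> = 0"
      using that(1) by (metis mod_mult_self2_is_0)
    finally show ?thesis
      using that(1) \<open>c \<ge> 2\<close> by simp
  qed
  have q: "q = int m" "b = 0"
    using quotient_unique[of "int m" q b] assms m by auto
  have \<rho>: "\<rho> = int m * int g" "\<beta> = 0"
    using quotient_unique[of "int m * int g" \<rho> \<beta>] assms m by (auto simp: ac_simps)
  \<comment> \<open>With \<open>c \<ge> 2\<close> this makes the denominator
    \<open>q * (q * c / 2) * (c - 1)\<close> nonzero. Since \<open>\<rho> = q * g\<close>, the
    quotient cancels to \<open>g\<^sup>2\<close>.\<close>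
  have "m > 0"
    using assms(1) m by (cases m) auto
  then have "real (card \<B>) =
             (real_of_int \<rho> * (real_of_int \<rho> * real c / 2 + real_of_int \<beta>) * (real c - 1)
                + real_of_int \<beta> / 2 * (real_of_int \<beta> - 1)) /
             (real_of_int q * (real_of_int q * real c / 2 + real_of_int b) * (real c - 1)
                + real_of_int b / 2 * (real_of_int b - 1))"
    using transversal_design_card_blocks[OF td] assms(1,3) q \<rho>
    by (simp add: field_simps power2_eq_square)
  moreover obtain f where "colouring c V {..<c} f" "block_equitable k c V \<B> {..<c} f"
    using transversal_design_equitable_colouring[of m c g V \<G> \<B>] td m assms(3) by auto
  moreover have "packing_design v k V \<B>"
    using transversal_design_imp_packing_design[OF td] assms(5) by simp
  ultimately show ?thesis
    by blast
qed

end
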